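(* Let $M\in\mathbb{R}^{n\times n}$ be a $P$-matrix, $b\in\mathbb{R}^n$, $A=[M\ \ -I_n]$, and denote by $w^*$ the unique point in $S_1\cap S_2$. Let $Q\in\{(AA^{\top})^{-1},I_n\}$, and let $f_Q$ and $L_Q$ be as in the context. Any sequence $\{w^k\}$ generated by $w^{k+1}\in P_{S_2}(w^k-\lambda\nabla f_Q(w^k))$ with $\lambda\in(0,1/L_Q]$ converges to $w^*$ with a local $Q$-linear rate. Moreover, the objective function values of $\min_{w}\ f_Q(w)+\delta_{S_2}(w)$ along $\{w^k\}$ converge to the global optimum of $0$ with a local $Q$-linear rate.
   Context: A square matrix is a $P$-matrix if all of its principal minors are positive; it is known that then $S_1\cap S_2$ below is a singleton for every $b$. Here $$S_1=\{w\in\mathbb{R}^{2n}:Aw=b\},\quad S_2=\{w\in\mathbb{R}^{2n}: w_j\ge0,\ w_{n+j}\ge0,\ w_jw_{n+j}=0\ \ \forall j\in\{1,\dots,n\}\}.$$ $\|\cdot\|$ is the Euclidean norm (operator norm for matrices); $P_{S_2}(w)=\arg\min_{z\in S_2}\|w-z\|$ (possibly set-valued); $\delta_{S_2}$ is the indicator function of $S_2$ ($0$ on $S_2$, $+\infty$ elsewhere). $f_Q(w)=\frac12w^{\top}A^{\top}QAw-w^{\top}A^{\top}Qb+\frac12b^{\top}Qb$, with $\nabla f_Q(w)=A^{\top}Q(Aw-b)$; $L_Q=1$ if $Q=(AA^{\top})^{-1}$ and $L_Q=\|A\|^2$ if $Q=I_n$. (For $Q=(AA^{\top})^{-1}$ and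 $\lambda=1$ the iteration is the method of alternating projections $w^{k+1}\in P_{S_2}(P_{S_1}(w^k))$.) A sequence $a^k\to a^*$ converges with a local $Q$-linear rate if there is $\kappa\in[0,1)$ with $\|a^{k+1}-a^*\|\le\kappa\|a^k-a^*\|$ for all sufficiently large $k$. *)

theory Defs
  imports "HOL-Analysis.Analysis"
begin

text \<open>
  The determinant of the principal submatrix of \<open>M\<close> with rows and columns in \<open>S\<close>, written out by
  the Leibniz formula (as in the library's \<open>det\<close>), because a submatrix indexed by a set rather
  than by a type is not an instance of \<open>det\<close>. Lemma \<open>principal_minor_range\<close> relates
  it to \<open>det\<close>.
\<close>
definition principal_minor :: "real^'n^'n \<Rightarrow> 'n set \<Rightarrow> real" where
  "principal_minor M S = (\<Sum>p | p permutes S. of_int (sign p) * (\<Prod>i\<in>S. M $ i $ p i))"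

lemma principal_minor_UNIV: "principal_minor M UNIV = det M"
  by (simp add: principal_minor_def det_def)

lemma principal_minor_range:
  fixes M :: "real^'n^'n" and f :: "'k::finite \<Rightarrow> 'n"
  assumes f: "inj f"
  shows "principal_minor M (range f) = det (\<chi> i j. M $ f i $ f j)"
proof -
  have bij: "bij_betw (map_permutation UNIV f) {p. p permutes UNIV} {p. p permutes range f}"
    using bij_betw_permutations[of f UNIV "range f"] f
    by (simp add: bij_betw_def map_permutation_def[abs_def] restrict_id_def[abs_def])
  have "principal_minor M (range f) =
      (\<Sum>p | p permutes (UNIV :: 'k set). of_int (sign (map_permutation UNIV f p)) *
        (\<Prod>i\<in>range f. M $ i $ map_permutation UNIV f p i))"
    unfolding principal_minor_def by (rule sum.reindex_bij_betw[OF bij, symmetric])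
  also have "\<dots> = (\<Sum>p | p permutes (UNIV :: 'k set). of_int (sign p) *
        (\<Prod>i\<in>UNIV. M $ f i $ f (p i)))"
  proof (rule sum.cong[OF refl])
    fix p :: "'k \<Rightarrow> 'k" assume "p \<in> {p. p permutes UNIV}"
    then have p: "p permutes UNIV" by simp
    have "sign (map_permutation UNIV f p) = sign p"
      using evenperm_map_permutation[OF f p] by (simp add: sign_def)
    then show "of_int (sign (map_permutation UNIV f p)) *
        (\<Prod>i\<in>range f. M $ i $ map_permutation UNIV f p i) =
        of_int (sign p) * (\<Prod>i\<in>UNIV. M $ f i $ f (p i))"
      by (simp add: prod.reindex[OF f] map_permutation_apply[OF f])
  qed
  finally show ?thesis by (simp add: det_def)
qed

definition P_matrix :: "real^'n^'n \<Rightarrow> bool" where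
  "P_matrix M \<longleftrightarrow> (\<forall>S. S \<noteq> {} \<longrightarrow> principal_minor M S > 0)"

text \<open>
  Vectors of length \<open>2n\<close> are indexed by the sum type \<open>'n + 'n\<close>: \<open>Inl j\<close> stands for the index
  \<open>j\<close> and \<open>Inr j\<close> for \<open>n + j\<close>. The following is the block matrix \<open>[M  -I]\<close>.
\<close>
definition lcp_matrix :: "real^'n^'n \<Rightarrow> real^('n + 'n)^'n" where
  "lcp_matrix M =
    (\<chi> i c. case c of Inl j \<Rightarrow> M $ i $ j | Inr j \<Rightarrow> - ((mat 1 :: real^'n^'n) $ i $ j))"

definition S1 :: "real^('n + 'n)^'n \<Rightarrow> real^'n \<Rightarrow> (real^('n + 'n)) set" where
  "S1 A b = {w. A *v w = b}"

definition S2 :: "(real^('n::finite + 'n)) set" where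
  "S2 = {w. \<forall>j. w $ Inl j \<ge> 0 \<and> w $ Inr j \<ge> 0 \<and> w $ Inl j * w $ Inr j = 0}"

definition proj_set :: "'a::real_normed_vector set \<Rightarrow> 'a \<Rightarrow> 'a set" where
  "proj_set S w = {z. is_arg_min (\<lambda>z. norm (w - z)) (\<lambda>z. z \<in> S) z}"

definition indicator_fun :: "'a set \<Rightarrow> 'a \<Rightarrow> ereal" where
  "indicator_fun S w = (if w \<in> S then 0 else \<infinity>)"

definition f_Q :: "real^'m^'n \<Rightarrow> real^'n \<Rightarrow> real^'n^'n \<Rightarrow> real^'m \<Rightarrow> real" where
  "f_Q A b Q w =
    1/2 * (w \<bullet> (transpose A *v (Q *v (A *v w)))) - w \<bullet> (transpose A *v (Q *v b))
      + 1/2 * (b \<bullet> (Q *v b))"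

text \<open>The gradient of \<open>f_Q\<close> when \<open>Q\<close> is symmetric; see \<open>GDERIV_f_Q\<close>.\<close>
definition grad_f_Q :: "real^'m^'n \<Rightarrow> real^'n \<Rightarrow> real^'n^'n \<Rightarrow> real^'m \<Rightarrow> real^'m" where
  "grad_f_Q A b Q w = transpose A *v (Q *v (A *v w - b))"

lemma GDERIV_f_Q:
  assumes Q: "transpose Q = Q"
  shows "GDERIV (f_Q A b Q) w :> grad_f_Q A b Q w"
proof -
  have sym: "x \<bullet> (Q *v y) = y \<bullet> (Q *v x)" for x y
    by (metis Q dot_lmul_matrix inner_commute transpose_matrix_vector)
  have tr: "x \<bullet> (transpose A *v y) = (A *v x) \<bullet> y" for x y
    by (metis dot_lmul_matrix inner_commute transpose_matrix_vector)
  have A: "((\<lambda>w. A *v w) has_derivative (\<lambda>h. A *v h)) (at w)"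
    by (rule bounded_linear_imp_has_derivative) simp
  have QA: "((\<lambda>w. Q *v (A *v w)) has_derivative (\<lambda>h. Q *v (A *v h))) (at w)"
    by (rule bounded_linear.has_derivative[OF matrix_vector_mul_bounded_linear A])
  have eq: "f_Q A b Q = (\<lambda>w. 1/2 * ((A *v w) \<bullet> (Q *v (A *v w))) - (A *v w) \<bullet> (Q *v b)
      + 1/2 * (b \<bullet> (Q *v b)))"
    by (rule ext) (simp add: f_Q_def tr del: transpose_matrix_vector)
  have "(f_Q A b Q has_derivative
      (\<lambda>h. 1/2 * ((A *v w) \<bullet> (Q *v (A *v h)) + (A *v h) \<bullet> (Q *v (A *v w)))
        - (A *v h) \<bullet> (Q *v b))) (at w)"
    unfolding eq by (rule derivative_eq_intros A QA refl | simp)+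
  moreover have "(\<lambda>h. 1/2 * ((A *v w) \<bullet> (Q *v (A *v h)) + (A *v h) \<bullet> (Q *v (A *v w)))
        - (A *v h) \<bullet> (Q *v b)) = (\<lambda>h. h \<bullet> grad_f_Q A b Q w)"
    by (rule ext) (simp add: grad_f_Q_def tr sym[of "A *v w"] matrix_vector_mult_diff_distrib
        inner_diff_right del: transpose_matrix_vector)
  ultimately show ?thesis by (simp add: gderiv_def)
qed

text \<open>
  Only the values at \<open>Q = (A A\<^sup>T)\<^sup>-\<^sup>1\<close> and \<open>Q = I\<close> matter. They do not conflict: for \<open>A = [M  -I]\<close>
  one has \<open>A A\<^sup>T = M M\<^sup>T + I\<close>, which differs from \<open>I\<close> unless \<open>M = 0\<close>.
\<close>
definition L_Q :: "real^'m^'n \<Rightarrow> real^'n^'n \<Rightarrow> real" where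
  "L_Q A Q = (if Q = matrix_inv (A ** transpose A) then 1 else (onorm (\<lambda>w. A *v w))\<^sup>2)"

definition objective ::
    "real^('n + 'n)^'n \<Rightarrow> real^'n \<Rightarrow> real^'n^'n \<Rightarrow> real^('n + 'n) \<Rightarrow> ereal" where
  "objective A b Q w = ereal (f_Q A b Q w) + indicator_fun S2 w"

definition local_Q_linear :: "(nat \<Rightarrow> 'a::real_normed_vector) \<Rightarrow> 'a \<Rightarrow> bool" where
  "local_Q_linear a l \<longleftrightarrow> a \<longlonglongrightarrow> l \<and>
    (\<exists>\<kappa>. 0 \<le> \<kappa> \<and> \<kappa> < 1 \<and> (\<forall>\<^sub>F k in sequentially. norm (a (Suc k) - l) \<le> \<kappa> * norm (a k - l)))"

text \<open>
  The same notion for extended real values; an objective value is infinite at a starting point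
  outside \<open>S2\<close>.
\<close>
definition local_Q_linear_ereal :: "(nat \<Rightarrow> ereal) \<Rightarrow> ereal \<Rightarrow> bool" where
  "local_Q_linear_ereal a l \<longleftrightarrow> a \<longlonglongrightarrow> l \<and>
    (\<exists>\<kappa>::real. 0 \<le> \<kappa> \<and> \<kappa> < 1 \<and>
      (\<forall>\<^sub>F k in sequentially. \<bar>a (Suc k) - l\<bar> \<le> ereal \<kappa> * \<bar>a k - l\<bar>))"

end

theory Submission
  imports Defs
begin

text \<open>
  A P-matrix reverses the sign of no nonzero vector. Since the difference of two points of \<open>S2\<close>
  has \<open>d\<^sub>j d\<^sub>n\<^sub>+\<^sub>j \<le> 0\<close> for all \<open>j\<close>, this yields a growth bound \<open>\<mu> |w - w*|\<^sup>2 \<le> 2 f\<^sub>Q w\<close> valid on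
  all of \<open>S2\<close>; applied to the transpose of \<open>M\<close> it shows that every stationary point solves \<open>A w = b\<close>.
  Existence of \<open>w*\<close> follows by minimising the residual over \<open>S2\<close>. The quadratic majorant of
  \<open>f\<^sub>Q\<close> with curvature \<open>1 / \<lambda>\<close> shows that cluster points of the iterates are stationary, so the iterates
  converge to \<open>w*\<close>. Near \<open>w*\<close> the set \<open>S2\<close> is star-shaped about \<open>w*\<close>, so the convex estimates for
  the projected gradient step apply and give both linear rates.
\<close>

section \<open>Sign reversal and P-matrices\<close>

text \<open>Inverting each permutation in the Leibniz sum exchanges rows and columns and keeps the
  sign. Stationarity on \<open>S2\<close> is a sign condition on the transpose of \<open>M\<close>,
  so the P-property must carry over.\<close>

lemma principal_minor_transpose: "principal_minor (transpose M) S = principal_minor M S"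
proof -
  have "principal_minor (transpose M) S =
      (\<Sum>p | p permutes S. of_int (sign (inv p)) * (\<Prod>i\<in>S. M $ inv p i $ i))"
    unfolding principal_minor_def
    by (subst sum_permutations_inverse) (simp add: transpose_def)
  also have "\<dots> = principal_minor M S"
    unfolding principal_minor_def
  proof (rule sum.cong[OF refl])
    fix p assume "p \<in> {p. p permutes S}"
    then have p: "p permutes S" by simp
    have "(\<Prod>i\<in>S. M $ inv p i $ i) = (\<Prod>i\<in>S. M $ inv p (p i) $ p i)"
      using prod.permute[OF p, of "\<lambda>i. M $ inv p i $ i"] by (simp add: o_def)
    also have "\<dots> = (\<Prod>i\<in>S. M $ i $ p i)"
      by (simp add: permutes_inverses(2)[OF p])
    finally have "(\<Prod>i\<in>S. M $ inv p i $ i) = (\<Prod>i\<in>S. M $ i $ p i)" .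
    moreover have "permutation p"
      using p by (auto simp: permutation_permutes)
    ultimately show "of_int (sign (inv p)) * (\<Prod>i\<in>S. M $ inv p i $ i) =
        of_int (sign p) * (\<Prod>i\<in>S. M $ i $ p i)"
      by (simp add: sign_inverse)
  qed
  finally show ?thesis .
qed

lemma P_matrix_transpose: "P_matrix M \<Longrightarrow> P_matrix (transpose M)"
  by (simp add: P_matrix_def principal_minor_transpose)

text \<open>A unit row at \<open>i\<close> kills every Leibniz term whose permutation moves
  \<open>i\<close>. This expresses set-indexed minors by a genuine \<open>det\<close>, where row
  operations are available.\<close>

lemma det_unit_rows_eq_principal_minor:
  fixes M :: "real^'n^'n"
  shows "det (\<chi> i. if i \<in> T then M $ i else axis i 1) = principal_minor M T"
proof -
  let ?N = "(\<chi> i. if i \<in> T then M $ i else axis i 1) :: real^'n^'n"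
  have "det ?N = (\<Sum>p | p permutes UNIV. of_int (sign p) * (\<Prod>i\<in>UNIV. ?N $ i $ p i))"
    by (simp add: det_def)
  also have "\<dots> = (\<Sum>p | p permutes T. of_int (sign p) * (\<Prod>i\<in>UNIV. ?N $ i $ p i))"
  proof (rule sum.mono_neutral_right)
    show "{p. p permutes T} \<subseteq> {p. p permutes (UNIV :: 'n set)}"
      using permutes_subset by blast
    show "\<forall>p\<in>{p. p permutes UNIV} - {p. p permutes T}.
        of_int (sign p) * (\<Prod>i\<in>UNIV. ?N $ i $ p i) = 0"
    proof
      fix p assume p: "p \<in> {p. p permutes UNIV} - {p. p permutes T}"
      then have "\<exists>i. i \<notin> T \<and> p i \<noteq> i"
        unfolding permutes_def by blast
      then obtain i where "i \<notin> T" "p i \<noteq> i" by blast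
      then have "?N $ i $ p i = 0" by (simp add: axis_def)
      then show "of_int (sign p) * (\<Prod>i\<in>UNIV. ?N $ i $ p i) = 0"
        by (metis (no_types, lifting) UNIV_I finite_class.finite_UNIV mult_zero_right prod_zero)
    qed
  qed (simp add: finite_permutations)
  also have "\<dots> = principal_minor M T"
    unfolding principal_minor_def
  proof (rule sum.cong[OF refl])
    fix p assume "p \<in> {p. p permutes T}"
    then have p: "p permutes T" by simp
    have "(\<Prod>i\<in>UNIV. ?N $ i $ p i) = (\<Prod>i\<in>T. ?N $ i $ p i)"
      by (rule prod.mono_neutral_right) (auto simp: axis_def permutes_not_in[OF p])
    then show "of_int (sign p) * (\<Prod>i\<in>UNIV. ?N $ i $ p i) =
        of_int (sign p) * (\<Prod>i\<in>T. M $ i $ p i)"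
      by simp
  qed
  finally show ?thesis .
qed

text \<open>Linearity in row \<open>k\<close> splits the determinant into one with the plain row
  (\<open>k\<close> joins \<open>T\<close>) plus \<open>d k\<close> times one with a unit row.
  Iterating gives a nonnegative combination of principal minors in which that of
  \<open>R \<union> T\<close> has coefficient 1.\<close>

lemma P_matrix_det_diagonal_pos:
  fixes M :: "real^'n^'n"
  assumes M: "P_matrix M" and d: "\<And>i. d i \<ge> 0" and "R \<inter> T = {}"
  shows "0 < det (\<chi> i. if i \<in> R then M $ i + d i *s axis i 1
    else if i \<in> T then M $ i else axis i 1)"
proof -
  have "finite R" by simp
  then show ?thesis using \<open>R \<inter> T = {}\<close>
  proof (induction R arbitrary: T rule: finite_induct)
    case empty
    \<comment> \<open>\<open>P_matrix\<close> speaks of nonempty sets only; the empty minor equals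
      1.\<close>
    have "principal_minor M T > 0"
      using M by (cases "T = {}") (auto simp: P_matrix_def principal_minor_def)
    then show ?case by (simp add: det_unit_rows_eq_principal_minor)
  next
    case (insert k R)
    let ?c = "\<lambda>i. if i \<in> R then M $ i + d i *s axis i 1
      else if i \<in> T then M $ i else axis i (1::real)"
    have "det (\<chi> i. if i \<in> insert k R then M $ i + d i *s axis i 1
        else if i \<in> T then M $ i else axis i 1) =
      det (\<chi> i. if i = k then M $ i + d i *s axis i 1 else ?c i)"
      by (rule arg_cong[where f = det]) (simp add: vec_eq_iff)
    also have "\<dots> = det (\<chi> i. if i = k then M $ i else ?c i) +
        det (\<chi> i. if i = k then d i *s axis i 1 else ?c i)"
      by (rule det_row_add)
    also have "det (\<chi> i. if i = k then d i *s axis i 1 else ?c i) =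
        det (\<chi> i. if i = k then d k *s axis i 1 else ?c i)"
      by (rule arg_cong[where f = det]) (simp add: vec_eq_iff)
    also have "\<dots> = d k * det (\<chi> i. if i = k then axis i 1 else ?c i)"
      by (rule det_row_mul)
    also have "(\<chi> i. if i = k then axis i 1 else ?c i) = (\<chi> i. ?c i)"
      using insert by (auto simp: vec_eq_iff)
    also have "(\<chi> i. if i = k then M $ i else ?c i) =
        (\<chi> i. if i \<in> R then M $ i + d i *s axis i 1
          else if i \<in> insert k T then M $ i else axis i 1)"
      using insert by (auto simp: vec_eq_iff)
    finally show ?case
      using insert.IH[of T] insert.IH[of "insert k T"] insert.hyps insert.prems d[of k]
      by (simp add: add_pos_nonneg)
  qed
qed

text \<open>On the support of a sign-reversed vector, \<open>M v + D v = 0\<close> with a nonnegative diagonal \<open>D\<close>.\<close>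
lemma P_matrix_no_sign_reversal:
  fixes M :: "real^'n^'n"
  assumes M: "P_matrix M" and v: "\<And>j. v $ j * (M *v v) $ j \<le> 0"
  shows "v = 0"
proof -
  define R where "R = {i. v $ i \<noteq> 0}"
  \<comment> \<open>Chosen to give \<open>(M *v v) $ i + d i * v $ i = 0\<close> on the support of
    \<open>v\<close>; elsewhere division by zero makes \<open>d i\<close> zero, and the unit rows of
    \<open>?N\<close> annihilate \<open>v\<close> there.\<close>
  define d where "d i = - ((M *v v) $ i / v $ i)" for i
  have d: "d i \<ge> 0" for i
    using v[of i] unfolding d_def by (auto simp: divide_le_0_iff mult_le_0_iff)
  let ?N = "(\<chi> i. if i \<in> R then M $ i + d i *s axis i 1
      else if i \<in> {} then M $ i else axis i 1) :: real^'n^'n"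
  have ax: "(\<Sum>j\<in>UNIV. axis i 1 $ j * v $ j) = v $ i" for i :: 'n
    by (simp add: axis_def if_distrib[of "\<lambda>x. x * _"] cong: if_cong)
  have "(?N *v v) $ i = 0" for i
  proof (cases "i \<in> R")
    case True
    then have "(?N *v v) $ i = (M *v v) $ i + d i * (\<Sum>j\<in>UNIV. axis i 1 $ j * v $ j)"
      by (simp add: matrix_vector_mult_def distrib_right sum.distrib sum_distrib_left mult.assoc)
    with True show ?thesis by (simp add: ax d_def R_def)
  next
    case False
    then have "(?N *v v) $ i = (\<Sum>j\<in>UNIV. axis i 1 $ j * v $ j)"
      by (simp add: matrix_vector_mult_def)
    with False show ?thesis by (simp add: ax R_def)
  qed
  then have "?N *v v = 0" by (simp add: vec_eq_iff)
  moreover have "invertible ?N"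
    using P_matrix_det_diagonal_pos[where d = d, OF M d, of R "{}"]
    by (simp add: invertible_det_nz)
  ultimately show "v = 0"
    using matrix_left_invertible_ker[of ?N] by (auto simp only: invertible_left_inverse)
qed

section \<open>Projected gradient steps for a quadratic function\<close>

text \<open>Here \<open>H\<close> is the Hessian of half of \<open>q\<close>, and \<open>S\<close>
  may be nonconvex. Strong convexity is replaced by \<open>growth\<close> relative to
  \<open>x0\<close>, convexity by \<open>star\<close> near \<open>x0\<close>, and
  \<open>stationary\<close> excludes other limits of the iteration.\<close>

locale projected_gradient =
  fixes S :: "'a::euclidean_space set" and H :: "'a \<Rightarrow> 'a" and x0 :: 'a and L \<mu> \<epsilon> lam :: real
  assumes closed_S: "closed S" and x0: "x0 \<in> S"
    and linear_H: "linear H" and H_sym: "x \<bullet> H y = y \<bullet> H x"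
    and H_cocoercive: "(norm (H x))\<^sup>2 \<le> L * (x \<bullet> H x)"
    and \<mu>: "\<mu> > 0" and growth: "x \<in> S \<Longrightarrow> \<mu> * (norm (x - x0))\<^sup>2 \<le> (x - x0) \<bullet> H (x - x0)"
    and \<epsilon>: "\<epsilon> > 0" and star: "x \<in> S \<Longrightarrow> dist x x0 < \<epsilon> \<Longrightarrow> closed_segment x x0 \<subseteq> S"
    and L: "L > 0" and lam: "lam > 0" "lam * L \<le> 1"
    and stationary: "x \<in> S \<Longrightarrow>
      (\<And>z. z \<in> S \<Longrightarrow> 0 \<le> H (x - x0) \<bullet> (z - x) + 1 / (2 * lam) * (norm (z - x))\<^sup>2) \<Longrightarrow> x = x0"
begin

abbreviation q :: "'a \<Rightarrow> real" where "q x \<equiv> (x - x0) \<bullet> H (x - x0)"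

lemma H_nonneg: "0 \<le> x \<bullet> H x"
  using H_cocoercive[of x] L by (metis order_trans zero_le_mult_iff zero_le_power2 not_le)

lemma H_le: "x \<bullet> H x \<le> (norm x)\<^sup>2 / lam"
proof -
  have "norm (H x) * norm (H x) \<le> L * norm x * norm (H x)"
    using H_cocoercive[of x] mult_left_mono[OF norm_cauchy_schwarz[of x "H x"] less_imp_le[OF L]]
    by (simp add: power2_eq_square mult.assoc)
  then have "norm (H x) \<le> L * norm x"
    using L by (cases "H x = 0") auto
  then have "x \<bullet> H x \<le> norm x * (L * norm x)"
    by (meson mult_left_mono norm_cauchy_schwarz norm_ge_zero order_trans)
  also have "\<dots> = L * (norm x)\<^sup>2" by (simp add: power2_eq_square)
  also have "\<dots> \<le> (1 / lam) * (norm x)\<^sup>2"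
    using lam by (intro mult_right_mono) (auto simp: field_simps)
  finally show ?thesis by simp
qed

text \<open>Completing the square shows that \<open>y\<close> minimises over \<open>S\<close> the
  quadratic model of half of \<open>q\<close> at \<open>x\<close> with curvature
  \<open>1 / lam\<close>. By \<open>H_le\<close> this model lies above half of \<open>q\<close>, so
  its value at any \<open>z\<close> in \<open>S\<close> bounds the new value.\<close>

lemma step_descent:
  assumes y: "y \<in> proj_set S (x - lam *\<^sub>R H (x - x0))" and z: "z \<in> S"
  shows "1/2 * q y \<le> 1/2 * q x + H (x - x0) \<bullet> (z - x) + 1 / (2 * lam) * (norm (z - x))\<^sup>2"
proof -
  define d e e' where "d = x - x0" and "e = y - x" and "e' = z - x"
  have "norm (x - lam *\<^sub>R H d - y) \<le> norm (x - lam *\<^sub>R H d - z)"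
    using y z by (auto simp: proj_set_def is_arg_min_linorder d_def)
  then have "norm (e + lam *\<^sub>R H d) \<le> norm (e' + lam *\<^sub>R H d)"
    unfolding e_def e'_def by (metis (no_types, lifting) diff_diff_eq2 minus_diff_eq norm_minus_cancel
      add.commute diff_add_eq)
  then have "(norm (e + lam *\<^sub>R H d))\<^sup>2 \<le> (norm (e' + lam *\<^sub>R H d))\<^sup>2"
    by (simp add: power_mono)
  then have "(norm e)\<^sup>2 + 2 * lam * (H d \<bullet> e) \<le> (norm e')\<^sup>2 + 2 * lam * (H d \<bullet> e')"
    by (simp add: power2_norm_eq_inner inner_add inner_commute algebra_simps)
  then have "(norm e)\<^sup>2 / lam + 2 * (H d \<bullet> e) \<le> (norm e')\<^sup>2 / lam + 2 * (H d \<bullet> e')"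
    using lam divide_right_mono[of "(norm e)\<^sup>2 + 2 * lam * (H d \<bullet> e)"
      "(norm e')\<^sup>2 + 2 * lam * (H d \<bullet> e')" lam]
    by (simp add: add_divide_distrib)
  moreover have "q y = d \<bullet> H d + 2 * (H d \<bullet> e) + e \<bullet> H e"
  proof -
    have "y - x0 = d + e" by (simp add: d_def e_def)
    then show ?thesis
      using H_sym[of d e]
      by (simp add: linear_add[OF linear_H] inner_add inner_commute)
  qed
  ultimately have "q y \<le> d \<bullet> H d + (norm e')\<^sup>2 / lam + 2 * (H d \<bullet> e')"
    using H_le[of e] by linarith
  then show ?thesis by (simp add: d_def e'_def)
qed

text \<open>The comparison point in \<open>step_descent\<close> lies on the segment from
  \<open>x\<close> to \<open>x0\<close>. Its linear term gains \<open>t * q x\<close>; by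
  \<open>growth\<close> and \<open>t \<le> lam * \<mu>\<close> the quadratic term returns at most
  half of that.\<close>

lemma step_value_contraction:
  assumes y: "y \<in> proj_set S (x - lam *\<^sub>R H (x - x0))" and x: "x \<in> S" "dist x x0 < \<epsilon>"
    and t: "0 < t" "t \<le> 1" "t \<le> lam * \<mu>"
  shows "q y \<le> (1 - t) * q x"
proof -
  let ?d = "x - x0"
  have "(1 - t) *\<^sub>R x + t *\<^sub>R x0 \<in> closed_segment x x0"
    using t by (auto simp: closed_segment_def)
  then have z: "x - t *\<^sub>R ?d \<in> S"
    using star[OF x] by (auto simp: algebra_simps)
  have "1/2 * q y \<le> 1/2 * q x - t * q x + 1 / (2 * lam) * (t\<^sup>2 * (norm ?d)\<^sup>2)"
    using step_descent[OF y z] t by (simp add: inner_commute power_mult_distrib)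
  moreover have "t\<^sup>2 * (norm ?d)\<^sup>2 \<le> (lam * t) * q x"
  proof -
    have "t * (norm ?d)\<^sup>2 \<le> (lam * \<mu>) * (norm ?d)\<^sup>2"
      using t by (intro mult_right_mono) auto
    also have "\<dots> \<le> lam * q x" using growth[OF x(1)] lam by simp
    finally show ?thesis using t by (simp add: power2_eq_square)
  qed
  then have "1 / (2 * lam) * (t\<^sup>2 * (norm ?d)\<^sup>2) \<le> 1/2 * t * q x"
    using lam by (simp add: field_simps)
  ultimately show ?thesis by (simp add: algebra_simps)
qed

text \<open>Since \<open>y\<close> is also closest to the gradient point \<open>u\<close> on the
  convex segment from \<open>y\<close> to \<open>x0\<close>, the angle at \<open>y\<close> is not
  acute, and \<open>y\<close> is no farther from \<open>x0\<close> than \<open>u\<close>.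
  Cocoercivity and \<open>growth\<close> contract the gradient step itself.\<close>

lemma step_distance_contraction:
  assumes y: "y \<in> proj_set S (x - lam *\<^sub>R H (x - x0))" and x: "x \<in> S" and yd: "dist y x0 < \<epsilon>"
  shows "(norm (y - x0))\<^sup>2 \<le> (1 - lam * \<mu>) * (norm (x - x0))\<^sup>2"
proof -
  define d u where "d = x - x0" and "u = x - lam *\<^sub>R H (x - x0)"
  have yS: "y \<in> S" and ymin: "z \<in> S \<Longrightarrow> dist u y \<le> dist u z" for z
    using y by (auto simp: proj_set_def is_arg_min_linorder dist_norm u_def)
  have "(u - y) \<bullet> (x0 - y) \<le> 0"
    by (rule any_closest_point_dot[of "closed_segment y x0"])
      (use ymin star[OF yS yd] in auto)
  then have "(norm (y - x0))\<^sup>2 \<le> (u - x0) \<bullet> (y - x0)"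
    by (simp add: power2_norm_eq_inner inner_diff inner_commute)
  also have "\<dots> \<le> norm (u - x0) * norm (y - x0)" by (rule norm_cauchy_schwarz)
  finally have "norm (y - x0) \<le> norm (u - x0)"
    by (cases "y = x0") (auto simp: power2_eq_square)
  then have "(norm (y - x0))\<^sup>2 \<le> (norm (u - x0))\<^sup>2" by (simp add: power_mono)
  also have "u - x0 = d - lam *\<^sub>R H d" by (simp add: u_def d_def)
  also have "(norm (d - lam *\<^sub>R H d))\<^sup>2 =
      (norm d)\<^sup>2 - 2 * lam * (d \<bullet> H d) + lam\<^sup>2 * (norm (H d))\<^sup>2"
    by (simp only: power2_norm_eq_inner) (simp add: inner_diff inner_commute power2_eq_square)
  also have "lam\<^sup>2 * (norm (H d))\<^sup>2 \<le> lam * (d \<bullet> H d)"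
  proof -
    have "lam\<^sup>2 * (norm (H d))\<^sup>2 \<le> lam\<^sup>2 * (L * (d \<bullet> H d))"
      by (intro mult_left_mono H_cocoercive) simp
    also have "\<dots> = lam * L * (lam * (d \<bullet> H d))" by (simp add: power2_eq_square)
    also have "\<dots> \<le> 1 * (lam * (d \<bullet> H d))"
      using lam H_nonneg[of d] by (intro mult_right_mono) auto
    finally show ?thesis by simp
  qed
  also have "(norm d)\<^sup>2 - 2 * lam * (d \<bullet> H d) + lam * (d \<bullet> H d) \<le> (1 - lam * \<mu>) * (norm d)\<^sup>2"
    using mult_left_mono[OF growth[OF x], of lam] lam by (simp add: d_def algebra_simps)
  finally show ?thesis by (simp add: d_def)
qed

section \<open>Convergence and linear rates of the iterates\<close>

context
  fixes w :: "nat \<Rightarrow> 'a"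
  assumes w: "\<And>k. w (Suc k) \<in> proj_set S (w k - lam *\<^sub>R H (w k - x0))"
begin

lemma iterate_in_S: "w (Suc k) \<in> S"
  using w[of k] by (simp add: proj_set_def is_arg_min_def)

lemma continuous_H: "continuous_on UNIV H"
  by (simp add: linear_H linear_continuous_on linear_conv_bounded_linear[symmetric])

text \<open>Along the iterates \<open>q\<close> decreases to a limit, so passing to the limit in \<open>step_descent\<close>
  cancels the two \<open>q\<close>-terms: every cluster point is stationary, even if \<open>lam * L = 1\<close>, where
  the step lengths need not be square summable.\<close>
lemma iterates_converge: "w \<longlonglongrightarrow> x0"
proof -
  \<comment> \<open>Indices start at 1 because \<open>w 0\<close> may lie outside
    \<open>S\<close>.\<close>
  have dec: "decseq (\<lambda>k. q (w (Suc k)))"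
  proof (rule decseq_SucI)
    show "q (w (Suc (Suc k))) \<le> q (w (Suc k))" for k
      using step_descent[OF w[of "Suc k"] iterate_in_S[of k]] by simp
  qed
  then obtain l where l: "(\<lambda>k. q (w (Suc k))) \<longlonglongrightarrow> l"
    by (rule decseq_convergent[where B = 0]) (simp add: H_nonneg)
  have "bounded (range (\<lambda>k. w (Suc k)))"
  proof -
    have "dist x0 (w (Suc k)) \<le> sqrt (q (w (Suc 0)) / \<mu>)" for k
    proof -
      have "\<mu> * (norm (w (Suc k) - x0))\<^sup>2 \<le> q (w (Suc 0))"
        using growth[OF iterate_in_S[of k]] decseqD[OF dec, of 0 k] by simp
      then have "(norm (w (Suc k) - x0))\<^sup>2 \<le> q (w (Suc 0)) / \<mu>"
        using \<mu> by (simp add: field_simps)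
      then show ?thesis by (simp add: real_le_rsqrt dist_norm norm_minus_commute)
    qed
    then show ?thesis by (auto simp: bounded_def)
  qed
  then obtain x r where r: "strict_mono r" and x: "(\<lambda>k. w (Suc (r k))) \<longlonglongrightarrow> x"
    using bounded_imp_convergent_subsequence[of "\<lambda>k. w (Suc k)"] by (auto simp: o_def)
  have xS: "x \<in> S"
    using closed_sequentially[OF closed_S _ x] iterate_in_S by blast
  have H_lim: "(\<lambda>k. H (w (Suc (r k)) - x0)) \<longlonglongrightarrow> H (x - x0)"
    by (rule continuous_on_tendsto_compose[OF continuous_H]) (auto intro!: tendsto_intros x)
  have q_lim: "(\<lambda>k. q (w (Suc (r k)))) \<longlonglongrightarrow> l"
    using LIMSEQ_subseq_LIMSEQ[OF l r] by (simp add: o_def)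
  \<comment> \<open>The successors of the subsequence need not converge, but their
    \<open>q\<close>-values form a subsequence with the same limit \<open>l\<close>.\<close>
  have "strict_mono (\<lambda>k. Suc (r k))" using r by (simp add: strict_mono_def)
  from LIMSEQ_subseq_LIMSEQ[OF l this]
  have q_lim': "(\<lambda>k. q (w (Suc (Suc (r k))))) \<longlonglongrightarrow> l" by (simp add: o_def)
  have "x = x0"
  proof (rule stationary[OF xS])
    fix z assume z: "z \<in> S"
    have "1/2 * l \<le> 1/2 * l + H (x - x0) \<bullet> (z - x) + 1 / (2 * lam) * (norm (z - x))\<^sup>2"
      by (rule LIMSEQ_le[rotated 2, where X = "\<lambda>k. 1/2 * q (w (Suc (Suc (r k))))" and
        Y = "\<lambda>k. 1/2 * q (w (Suc (r k))) + H (w (Suc (r k)) - x0) \<bullet> (z - w (Suc (r k)))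
          + 1 / (2 * lam) * (norm (z - w (Suc (r k))))\<^sup>2"])
        (use step_descent[OF w z] lam in \<open>auto intro!: tendsto_intros q_lim q_lim' H_lim x\<close>)
    then show "0 \<le> H (x - x0) \<bullet> (z - x) + 1 / (2 * lam) * (norm (z - x))\<^sup>2" by simp
  qed
  \<comment> \<open>Now \<open>l = q x0 = 0\<close>, and \<open>growth\<close> turns this into
    convergence of the whole sequence.\<close>
  have "(\<lambda>k. q (w (Suc (r k)))) \<longlonglongrightarrow> q x"
    by (auto intro!: tendsto_intros H_lim x)
  with q_lim \<open>x = x0\<close> have "l = 0"
    using LIMSEQ_unique by fastforce
  have "(\<lambda>k. q (w (Suc k)) / \<mu>) \<longlonglongrightarrow> 0"
    using tendsto_divide[OF l tendsto_const, of \<mu>] \<mu> \<open>l = 0\<close> by simp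
  moreover have "(norm (w (Suc k) - x0))\<^sup>2 \<le> q (w (Suc k)) / \<mu>" for k
    using growth[OF iterate_in_S[of k]] \<mu> by (simp add: field_simps)
  ultimately have "(\<lambda>k. (norm (w (Suc k) - x0))\<^sup>2) \<longlonglongrightarrow> 0"
    using tendsto_sandwich[of "\<lambda>_. 0" "\<lambda>k. (norm (w (Suc k) - x0))\<^sup>2" sequentially
      "\<lambda>k. q (w (Suc k)) / \<mu>" 0] by simp
  then have "(\<lambda>k. w (Suc k) - x0) \<longlonglongrightarrow> 0"
    using tendsto_norm_zero_iff by (auto simp: tendsto_norm_zero_iff dest!: tendsto_real_sqrt)
  then show ?thesis
    by (simp add: LIM_zero_iff filterlim_sequentially_Suc)
qed

lemma iterates_eventually_near: "\<forall>\<^sub>F k in sequentially.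
    w k \<in> S \<and> dist (w k) x0 < \<epsilon> \<and> dist (w (Suc k)) x0 < \<epsilon>"
proof -
  have near: "\<forall>\<^sub>F k in sequentially. dist (w k) x0 < \<epsilon>"
    using iterates_converge \<epsilon> by (rule tendstoD)
  then have "\<forall>\<^sub>F k in sequentially. dist (w (Suc k)) x0 < \<epsilon>"
    by (rule eventually_sequentially_Suc[THEN iffD2])
  moreover have "\<forall>\<^sub>F k in sequentially. w k \<in> S"
    using eventually_gt_at_top[of 0]
    by eventually_elim (metis iterate_in_S gr0_conv_Suc)
  ultimately show ?thesis using near by eventually_elim simp
qed

lemma iterates_local_Q_linear: "local_Q_linear w x0"
proof -
  \<comment> \<open>The contraction concerns squared norms, hence the root; \<open>max 0\<close>
    keeps the radicand nonnegative without a proof of \<open>lam * \<mu> \<le> 1\<close>.\<close>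
  define \<kappa> where "\<kappa> = sqrt (max 0 (1 - lam * \<mu>))"
  have "\<forall>\<^sub>F k in sequentially. norm (w (Suc k) - x0) \<le> \<kappa> * norm (w k - x0)"
    using iterates_eventually_near
  proof eventually_elim
    case (elim k)
    then have "(norm (w (Suc k) - x0))\<^sup>2 \<le> (1 - lam * \<mu>) * (norm (w k - x0))\<^sup>2"
      by (intro step_distance_contraction w) auto
    also have "\<dots> \<le> max 0 (1 - lam * \<mu>) * (norm (w k - x0))\<^sup>2"
      by (intro mult_right_mono) auto
    also have "\<dots> = (\<kappa> * norm (w k - x0))\<^sup>2" by (simp add: \<kappa>_def power_mult_distrib)
    finally show ?case by (rule power2_le_imp_le) (simp add: \<kappa>_def)
  qed
  moreover have "0 \<le> \<kappa>" "\<kappa> < 1" using lam \<mu> by (auto simp: \<kappa>_def)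
  ultimately show ?thesis
    unfolding local_Q_linear_def using iterates_converge by blast
qed

lemma values_converge: "(\<lambda>k. q (w k)) \<longlonglongrightarrow> 0"
proof -
  have "(\<lambda>k. H (w k - x0)) \<longlonglongrightarrow> H (x0 - x0)"
    by (rule continuous_on_tendsto_compose[OF continuous_H
          tendsto_diff[OF iterates_converge tendsto_const]]) auto
  then have "(\<lambda>k. q (w k)) \<longlonglongrightarrow> q x0"
    by (intro tendsto_intros iterates_converge)
  then show ?thesis by simp
qed

lemma values_linear_rate:
  obtains \<kappa> where "0 \<le> \<kappa>" "\<kappa> < 1" "\<forall>\<^sub>F k in sequentially. q (w (Suc k)) \<le> \<kappa> * q (w k)"
proof
  \<comment> \<open>The largest \<open>t\<close> that \<open>step_value_contraction\<close>
    admits.\<close>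
  let ?t = "min 1 (lam * \<mu>)"
  show "0 \<le> 1 - ?t" "1 - ?t < 1" using lam \<mu> by auto
  show "\<forall>\<^sub>F k in sequentially. q (w (Suc k)) \<le> (1 - ?t) * q (w k)"
    using iterates_eventually_near
    by eventually_elim (rule step_value_contraction[OF w], use lam \<mu> in auto)
qed

end

end

section \<open>Complementarity\<close>

text \<open>The quadratic form has a positive minimum on the compact set of unit vectors in
  \<open>K\<close>; homogeneity of degree two extends the bound to the cone.\<close>

lemma closed_cone_quadratic_growth:
  fixes H :: "'a::euclidean_space \<Rightarrow> 'a"
  assumes H: "linear H" and K: "closed K" "cone K" and pos: "\<And>x. x \<in> K \<Longrightarrow> x \<noteq> 0 \<Longrightarrow> 0 < x \<bullet> H x"
  obtains \<mu> where "\<mu> > 0" "\<And>x. x \<in> K \<Longrightarrow> \<mu> * (norm x)\<^sup>2 \<le> x \<bullet> H x"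
proof -
  have normalised: "(1 / norm x) *\<^sub>R x \<in> K \<inter> sphere 0 1" if "x \<in> K" "x \<noteq> 0" for x
    using that K(2) by (simp add: cone_def)
  have "\<exists>\<mu>>0. \<forall>y \<in> K \<inter> sphere 0 1. \<mu> \<le> y \<bullet> H y"
  proof (cases "K \<inter> sphere 0 1 = {}")
    case True
    then show ?thesis by (auto intro: exI[of _ 1])
  next
    case False
    have "continuous_on (K \<inter> sphere 0 1) (\<lambda>y. y \<bullet> H y)"
      using H by (intro continuous_intros linear_continuous_on) (simp add: linear_conv_bounded_linear)
    moreover have "compact (K \<inter> sphere 0 1)"
      using K(1) by (simp add: closed_Int_compact)
    ultimately obtain y where y: "y \<in> K \<inter> sphere 0 1" "\<forall>z \<in> K \<inter> sphere 0 1. y \<bullet> H y \<le> z \<bullet> H z"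
      using continuous_attains_inf False by blast
    then have "y \<noteq> 0" by auto
    then show ?thesis using y pos[of y] by (intro exI[of _ "y \<bullet> H y"]) auto
  qed
  then obtain \<mu> where \<mu>: "\<mu> > 0" and le: "\<And>y. y \<in> K \<inter> sphere 0 1 \<Longrightarrow> \<mu> \<le> y \<bullet> H y" by blast
  have "\<mu> * (norm x)\<^sup>2 \<le> x \<bullet> H x" if "x \<in> K" for x
  proof (cases "x = 0")
    case False
    have "\<mu> \<le> (x \<bullet> H x) / (norm x)\<^sup>2"
      using le[OF normalised[OF that False]]
      by (simp add: linear_cmul[OF H] power2_eq_square)
    then show ?thesis using False by (simp add: field_simps)
  qed simp
  then show ?thesis using that \<mu> by blast
qed

section \<open>The block matrix and pairs of opposite sign\<close>

lemma lcp_matrix_transpose_mult: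
  "(transpose (lcp_matrix M) *v v) $ Inl j = (transpose M *v v) $ j"
  "(transpose (lcp_matrix M) *v v) $ Inr j = - v $ j"
proof -
  show "(transpose (lcp_matrix M) *v v) $ Inl j = (transpose M *v v) $ j"
    by (simp add: matrix_vector_mult_def transpose_def lcp_matrix_def del: transpose_matrix_vector)
  show "(transpose (lcp_matrix M) *v v) $ Inr j = - v $ j"
    by (simp add: matrix_vector_mult_def transpose_def lcp_matrix_def mat_def
        if_distrib[of "\<lambda>x. x * _"] sum_negf del: transpose_matrix_vector cong: if_cong)
qed

lemma lcp_matrix_mult:
  "lcp_matrix M *v w = M *v (\<chi> j. w $ Inl j) - (\<chi> j. w $ Inr j)"
proof -
  have "(lcp_matrix M *v w) $ i = (M *v (\<chi> j. w $ Inl j)) $ i - w $ Inr i" for i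
  proof -
    have "(lcp_matrix M *v w) $ i =
        (\<Sum>j\<in>UNIV. M $ i $ j * w $ Inl j) + (\<Sum>j\<in>UNIV. - ((mat 1 :: real^'a^'a) $ i $ j) * w $ Inr j)"
      unfolding matrix_vector_mult_def lcp_matrix_def UNIV_Plus_UNIV[symmetric]
      by (simp add: sum.Plus del: UNIV_Plus_UNIV)
    then show ?thesis
      by (simp add: matrix_vector_mult_def mat_def sum_negf
          if_distrib[of "\<lambda>x. x * _"] cong: if_cong)
  qed
  then show ?thesis by (simp add: vec_eq_iff)
qed

text \<open>A closed cone containing all differences of points of \<open>S2\<close>, so that
  \<open>closed_cone_quadratic_growth\<close> applies.\<close>

definition opposite_sign_cone :: "(real^('n::finite + 'n)) set" where
  "opposite_sign_cone = {d. \<forall>j. d $ Inl j * d $ Inr j \<le> 0}"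

lemma closed_opposite_sign_cone: "closed opposite_sign_cone"
  unfolding opposite_sign_cone_def
  by (intro closed_Collect_all closed_Collect_le continuous_intros)

lemma cone_opposite_sign_cone: "cone opposite_sign_cone"
proof -
  have "c * x * (c * y) \<le> 0" if "x * y \<le> 0" for c x y :: real
    using mult_nonneg_nonpos[OF zero_le_square[of c] that] by (simp only: ac_simps)
  then show ?thesis by (simp add: cone_def opposite_sign_cone_def)
qed

lemma S2_diff_opposite_sign:
  assumes "w \<in> S2" "z \<in> S2"
  shows "w - z \<in> opposite_sign_cone"
  unfolding opposite_sign_cone_def
proof safe
  fix j
  have "w $ Inl j * w $ Inr j = 0" "z $ Inl j * z $ Inr j = 0"
    using assms by (simp_all add: S2_def)
  then have "(w - z) $ Inl j * (w - z) $ Inr j = - (w $ Inl j * z $ Inr j) - z $ Inl j * w $ Inr j"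
    by (simp only: vector_minus_component left_diff_distrib right_diff_distrib)
  moreover have "0 \<le> w $ Inl j * z $ Inr j" "0 \<le> z $ Inl j * w $ Inr j"
    using assms unfolding S2_def by (intro mult_nonneg_nonneg; blast)+
  ultimately show "(w - z) $ Inl j * (w - z) $ Inr j \<le> 0" by linarith
qed

lemma zero_in_S2: "0 \<in> S2"
  by (simp add: S2_def)

lemma S2_subset_opposite_sign_cone: "S2 \<subseteq> opposite_sign_cone"
  using S2_diff_opposite_sign[OF _ zero_in_S2] by auto

text \<open>The equation makes the second half of \<open>d\<close> the image under \<open>M\<close>
  of the first, so the cone condition says that \<open>M\<close> reverses the sign of the first
  half. This gives uniqueness of the solution and positivity for the growth bound.\<close>

lemma P_matrix_lcp_kernel:
  assumes M: "P_matrix M" and d: "d \<in> opposite_sign_cone" and Ad: "lcp_matrix M *v d = 0"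
  shows "d = 0"
proof -
  have y: "d $ Inr j = (M *v (\<chi> j. d $ Inl j)) $ j" for j
    using Ad unfolding lcp_matrix_mult by (simp add: vec_eq_iff)
  have x: "(\<chi> j. d $ Inl j) = 0"
    by (rule P_matrix_no_sign_reversal[OF M]) (use d in \<open>auto simp: opposite_sign_cone_def y[symmetric]\<close>)
  have "d $ c = 0" for c
  proof (cases c)
    case (Inl j)
    with x show ?thesis by (simp add: vec_eq_iff)
  next
    case (Inr j)
    with x y[of j] show ?thesis by simp
  qed
  then show ?thesis by (simp add: vec_eq_iff)
qed

section \<open>Local geometry of \<open>S2\<close> and its stationary points\<close>

lemma closed_S2: "closed S2"
  unfolding S2_def
  by (intro closed_Collect_all closed_Collect_conj closed_Collect_le closed_Collect_eq
      continuous_intros)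

text \<open>Components positive at \<open>w0\<close> stay positive nearby, so their partners vanish
  at both endpoints and along the segment. Where a pair of \<open>w0\<close> is zero, the segment
  only rescales the pair of \<open>w\<close>.\<close>

lemma S2_locally_star_shaped:
  assumes w0: "w0 \<in> S2"
  obtains \<epsilon> where "\<epsilon> > 0" "\<And>w. w \<in> S2 \<Longrightarrow> dist w w0 < \<epsilon> \<Longrightarrow> closed_segment w w0 \<subseteq> S2"
proof
  \<comment> \<open>The inserted 1 keeps the minimum well defined when
    \<open>w0 = 0\<close>.\<close>
  define \<epsilon> where "\<epsilon> = Min (insert 1 ((\<lambda>c. w0 $ c) ` {c. w0 $ c > 0}))"
  show "\<epsilon> > 0" unfolding \<epsilon>_def by (subst Min_gr_iff) auto
  fix w assume w: "w \<in> S2" and near: "dist w w0 < \<epsilon>"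
  have pos: "w $ c > 0" if "w0 $ c > 0" for c
  proof -
    have "\<epsilon> \<le> w0 $ c" unfolding \<epsilon>_def using that by (intro Min_le) auto
    moreover have "\<bar>w $ c - w0 $ c\<bar> < \<epsilon>"
      using near component_le_norm_cart[of "w - w0" c] by (simp add: dist_norm)
    ultimately show ?thesis by linarith
  qed
  show "closed_segment w w0 \<subseteq> S2"
  proof
    fix z assume "z \<in> closed_segment w w0"
    then obtain u where u: "0 \<le> u" "u \<le> 1" and z: "z = (1 - u) *\<^sub>R w + u *\<^sub>R w0"
      by (auto simp: closed_segment_def)
    have "z $ Inl j * z $ Inr j = 0" for j
    proof -
      have s: "w $ Inl j * w $ Inr j = 0" "w0 $ Inl j * w0 $ Inr j = 0"
        "w0 $ Inl j \<ge> 0" "w0 $ Inr j \<ge> 0"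
        using w w0 by (auto simp: S2_def)
      consider "w0 $ Inl j > 0" | "w0 $ Inr j > 0" | "w0 $ Inl j = 0" "w0 $ Inr j = 0"
        using s(3,4) by linarith
      then show ?thesis
      proof cases
        case 1
        with s pos[of "Inl j"] show ?thesis by (auto simp: z)
      next
        case 2
        with s pos[of "Inr j"] show ?thesis by (auto simp: z)
      next
        case 3
        with s show ?thesis by (auto simp: z)
      qed
    qed
    then show "z \<in> S2" using u w w0 by (simp add: S2_def z)
  qed
qed

text \<open>Dividing by \<open>s\<close> and letting it tend to 0 removes the quadratic term. The
  bound \<open>m\<close> allows for directions in which only a limited move stays in
  \<open>S2\<close>.\<close>

lemma first_order_nonneg:
  fixes a C m :: real
  assumes m: "m > 0" and le: "\<And>s. 0 < s \<Longrightarrow> s \<le> m \<Longrightarrow> 0 \<le> s * a + C * s\<^sup>2"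
  shows "0 \<le> a"
proof (rule tendsto_lowerbound)
  show "((\<lambda>s. a + C * s) \<longlongrightarrow> a) (at_right 0)"
    by (rule tendsto_eq_intros refl | simp)+
  show "\<forall>\<^sub>F s in at_right 0. 0 \<le> a + C * s"
    using eventually_at_right_less[of 0] eventually_at_right_real[OF m]
  proof eventually_elim
    case (elim s)
    then have "0 \<le> s * (a + C * s)"
      using le[of s] by (simp add: algebra_simps power2_eq_square)
    with elim show ?case by (simp add: zero_le_mult_iff)
  qed
qed simp

text \<open>With \<open>A = [M  -I]\<close>, the pair of components of \<open>A\<^sup>T v\<close> at \<open>j\<close> is \<open>(M\<^sup>T v)\<^sub>j, -v\<^sub>j\<close>. At a
  stationary point one of them vanishes or both are nonnegative, so \<open>M\<^sup>T\<close> reverses the sign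
  of \<open>v\<close>.\<close>
lemma S2_stationary:
  assumes M: "P_matrix M" and w: "w \<in> S2"
    and stat: "\<And>z. z \<in> S2 \<Longrightarrow>
      0 \<le> (transpose (lcp_matrix M) *v v) \<bullet> (z - w) + C * (norm (z - w))\<^sup>2"
  shows "v = 0"
proof -
  define g where "g = transpose (lcp_matrix M) *v v"
  have move: "0 \<le> s * g $ c + C * s\<^sup>2" if "w + s *\<^sub>R axis c 1 \<in> S2" for s c
    using stat[OF that, folded g_def] by (simp add: inner_axis power_mult_distrib)
  \<comment> \<open>A component whose partner is zero can be increased freely within
    \<open>S2\<close>.\<close>
  have nonneg: "0 \<le> g $ Inl j" if "w $ Inr j = 0" for j
  proof (rule first_order_nonneg[OF zero_less_one])
    fix s :: real assume "0 < s"
    then have "w + s *\<^sub>R axis (Inl j) 1 \<in> S2"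
      using w that by (auto simp: S2_def axis_def)
    then show "0 \<le> s * g $ Inl j + C * s\<^sup>2" by (rule move)
  qed
  have nonneg': "0 \<le> g $ Inr j" if "w $ Inl j = 0" for j
  proof (rule first_order_nonneg[OF zero_less_one])
    fix s :: real assume "0 < s"
    then have "w + s *\<^sub>R axis (Inr j) 1 \<in> S2"
      using w that by (auto simp: S2_def axis_def)
    then show "0 \<le> s * g $ Inr j + C * s\<^sup>2" by (rule move)
  qed
  \<comment> \<open>A positive component has a zero partner and can be decreased down to 0, hence
    the step bound \<open>w $ c\<close>.\<close>
  have nonpos: "g $ c \<le> 0" if "w $ c > 0" for c
  proof -
    have "0 \<le> - g $ c"
    proof (rule first_order_nonneg[OF that])
      fix s assume s: "0 < s" "s \<le> w $ c"
      have "w + (- s) *\<^sub>R axis c 1 \<in> S2"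
      proof (cases c)
        case (Inl j)
        have "w $ Inl j * w $ Inr j = 0" using w by (simp add: S2_def)
        then have "w $ Inr j = 0" using that Inl by simp
        then show ?thesis using w s Inl by (auto simp: S2_def axis_def)
      next
        case (Inr j)
        have "w $ Inl j * w $ Inr j = 0" using w by (simp add: S2_def)
        then have "w $ Inl j = 0" using that Inr by simp
        then show ?thesis using w s Inr by (auto simp: S2_def axis_def)
      qed
      from move[OF this] show "0 \<le> s * - g $ c + C * s\<^sup>2" by simp
    qed
    then show ?thesis by simp
  qed
  have "0 \<le> g $ Inl j * g $ Inr j" for j
  proof -
    have wj: "w $ Inl j \<ge> 0" "w $ Inr j \<ge> 0" "w $ Inl j = 0 \<or> w $ Inr j = 0"
      using w by (auto simp: S2_def)
    consider "w $ Inl j > 0" "w $ Inr j = 0" | "w $ Inr j > 0" "w $ Inl j = 0"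
      | "w $ Inl j = 0" "w $ Inr j = 0"
      using wj by fastforce
    then show ?thesis
    proof cases
      case 1
      then have "g $ Inl j = 0" using nonneg nonpos by (simp add: order_antisym)
      then show ?thesis by simp
    next
      case 2
      then have "g $ Inr j = 0" using nonneg' nonpos by (simp add: order_antisym)
      then show ?thesis by simp
    next
      case 3
      then show ?thesis using nonneg nonneg' by simp
    qed
  qed
  then have "v $ j * (transpose M *v v) $ j \<le> 0" for j
    by (simp add: g_def lcp_matrix_transpose_mult mult.commute del: transpose_matrix_vector)
  then show ?thesis by (rule P_matrix_no_sign_reversal[OF P_matrix_transpose[OF M]])
qed

section \<open>Growth of the residual and existence of a solution\<close>

lemma inner_transpose_mult:
  fixes A :: "real^'m^'n"
  shows "x \<bullet> (transpose A *v y) = (A *v x) \<bullet> y"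
  by (metis dot_lmul_matrix inner_commute transpose_matrix_vector)

lemma linear_normal_map: "linear (\<lambda>x. transpose A *v (Q *v (A *v x)))"
  for A :: "real^'m^'n" and Q :: "real^'n^'n"
  by (simp add: matrix_vector_mul_assoc del: transpose_matrix_vector)

lemma P_matrix_lcp_growth:
  fixes M :: "real^'n^'n"
  assumes M: "P_matrix M" and Q: "\<And>y. y \<noteq> 0 \<Longrightarrow> 0 < y \<bullet> (Q *v y)"
  obtains \<mu> where "\<mu> > 0" "\<And>x. x \<in> opposite_sign_cone \<Longrightarrow>
    \<mu> * (norm x)\<^sup>2 \<le> x \<bullet> (transpose (lcp_matrix M) *v (Q *v (lcp_matrix M *v x)))"
proof (rule closed_cone_quadratic_growth[OF linear_normal_map closed_opposite_sign_cone
      cone_opposite_sign_cone])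
  fix x :: "real^('n + 'n)" assume "x \<in> opposite_sign_cone" "x \<noteq> 0"
  then show "0 < x \<bullet> (transpose (lcp_matrix M) *v (Q *v (lcp_matrix M *v x)))"
    unfolding inner_transpose_mult using P_matrix_lcp_kernel[OF M] by (intro Q) blast
qed (rule that)

text \<open>The least squares residual attains its minimum over \<open>S2\<close>, and stationarity makes it zero.\<close>
lemma P_matrix_lcp_solvable:
  fixes M :: "real^'n^'n"
  assumes M: "P_matrix M"
  obtains w where "w \<in> S2" "lcp_matrix M *v w = b"
proof -
  let ?A = "lcp_matrix M"
  obtain \<mu> where \<mu>: "\<mu> > 0" and growth: "\<And>x. x \<in> opposite_sign_cone \<Longrightarrow>
      \<mu> * (norm x)\<^sup>2 \<le> x \<bullet> (transpose ?A *v (mat 1 *v (?A *v x)))"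
    using P_matrix_lcp_growth[OF M, of "mat 1"] by auto
  have growth': "sqrt \<mu> * norm x \<le> norm (?A *v x)" if "x \<in> S2" for x
  proof (rule power2_le_imp_le)
    show "(sqrt \<mu> * norm x)\<^sup>2 \<le> (norm (?A *v x))\<^sup>2"
      using growth[of x] that S2_subset_opposite_sign_cone \<mu>
      unfolding inner_transpose_mult by (auto simp: power_mult_distrib power2_norm_eq_inner)
  qed simp
  \<comment> \<open>Outside this ball \<open>growth'\<close> makes \<open>norm (?A *v z)\<close> at
    least \<open>2 * norm b\<close>, so the residual is no smaller than at 0 and a minimum over the
    ball is global.\<close>
  define R where "R = 2 * norm b / sqrt \<mu>"
  have "compact (S2 \<inter> cball 0 R :: (real^('n + 'n)) set)"
    by (simp add: closed_S2 closed_Int_compact)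
  moreover have "0 \<in> S2 \<inter> cball (0 :: real^('n + 'n)) R"
    using \<mu> by (simp add: zero_in_S2 R_def)
  moreover have "continuous_on (S2 \<inter> cball 0 R) (\<lambda>w. norm (?A *v w - b))"
    by (intro continuous_intros linear_continuous_on) simp
  ultimately obtain w where w: "w \<in> S2 \<inter> cball 0 R"
    and min: "\<forall>z \<in> S2 \<inter> cball 0 R. norm (?A *v w - b) \<le> norm (?A *v z - b)"
    using continuous_attains_inf[of "S2 \<inter> cball 0 R" "\<lambda>w. norm (?A *v w - b)"] by blast
  have min: "norm (?A *v w - b) \<le> norm (?A *v z - b)" if z: "z \<in> S2" for z
  proof (cases "norm z \<le> R")
    case False
    have "norm (?A *v w - b) \<le> norm (?A *v 0 - b)"
      using min \<open>0 \<in> S2 \<inter> cball 0 R\<close> by blast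
    also have "\<dots> = 2 * norm b - norm b" by simp
    also have "\<dots> \<le> norm (?A *v z) - norm b"
    proof -
      have "2 * norm b \<le> sqrt \<mu> * norm z"
        using False \<mu> by (simp add: R_def field_simps)
      then show ?thesis using growth'[OF z] by simp
    qed
    also have "\<dots> \<le> norm (?A *v z - b)" by (rule norm_triangle_ineq2)
    finally show ?thesis .
  qed (use min z in auto)
  define v where "v = ?A *v w - b"
  \<comment> \<open>The second-order part of the squared residual supplies the constant
    \<open>C = ?K\<^sup>2 / 2\<close> for \<open>S2_stationary\<close>.\<close>
  let ?K = "onorm (\<lambda>x. ?A *v x)"
  have "v = 0"
  proof (rule S2_stationary[OF M])
    show "w \<in> S2" using w by simp
    fix z :: "real^('n + 'n)" assume z: "z \<in> S2"
    define e where "e = z - w"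
    have "?A *v z - b = v + ?A *v e"
      by (simp add: v_def e_def matrix_vector_mult_diff_distrib)
    then have "(norm v)\<^sup>2 \<le> (norm (v + ?A *v e))\<^sup>2"
      using min[OF z, folded v_def] by (simp add: power_mono)
    also have "\<dots> = (norm v)\<^sup>2 + 2 * (v \<bullet> (?A *v e)) + (norm (?A *v e))\<^sup>2"
      by (simp add: power2_norm_eq_inner inner_add inner_commute)
    also have "(norm (?A *v e))\<^sup>2 \<le> (?K * norm e)\<^sup>2"
      by (intro power_mono onorm) simp_all
    finally have "0 \<le> v \<bullet> (?A *v e) + ?K\<^sup>2 / 2 * (norm e)\<^sup>2"
      by (simp add: power_mult_distrib)
    then show "0 \<le> (transpose ?A *v v) \<bullet> (z - w) + ?K\<^sup>2 / 2 * (norm (z - w))\<^sup>2"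
      using inner_transpose_mult[of e ?A v] by (simp add: e_def inner_commute del: transpose_matrix_vector)
  qed
  then show ?thesis using that[of w] w by (simp add: v_def)
qed

section \<open>Weighted least squares\<close>

text \<open>Pairing \<open>A *v ?z\<close> with \<open>y\<close> gives the squared norm of
  \<open>?z\<close>; one factor cancels after Cauchy-Schwarz.\<close>

lemma transpose_mult_norm_le:
  fixes A :: "real^'m^'n"
  shows "norm (transpose A *v y) \<le> onorm (\<lambda>w. A *v w) * norm y"
proof -
  let ?z = "transpose A *v y"
  have "norm ?z * norm ?z = (A *v ?z) \<bullet> y"
    by (metis inner_transpose_mult power2_eq_square power2_norm_eq_inner)
  also have "\<dots> \<le> norm (A *v ?z) * norm y" by (rule norm_cauchy_schwarz)
  also have "\<dots> \<le> (onorm (\<lambda>w. A *v w) * norm ?z) * norm y"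
    by (intro mult_right_mono onorm) simp_all
  finally have *: "norm ?z * norm ?z \<le> onorm (\<lambda>w. A *v w) * norm y * norm ?z"
    by (simp only: ac_simps)
  show ?thesis
  proof (cases "?z = 0")
    case True
    then show ?thesis by (simp add: onorm_pos_le del: transpose_matrix_vector)
  next
    case False
    with * show ?thesis by (simp del: transpose_matrix_vector)
  qed
qed

text \<open>For the inverse weight, \<open>y \<bullet> (Q *v y)\<close> equals the squared norm of
  \<open>transpose A *v (Q *v y)\<close>, so the constant 1 is attained with equality. For the
  identity the bound is \<open>transpose_mult_norm_le\<close>. The case split mirrors the
  conditional in \<open>L_Q\<close>.\<close>

lemma weight_properties:
  fixes A :: "real^'m^'n"
  assumes inj: "\<And>y. transpose A *v y = 0 \<Longrightarrow> y = 0" and Q: "Q \<in> {matrix_inv (A ** transpose A), mat 1}"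
  shows "transpose Q = Q" and "y \<noteq> 0 \<Longrightarrow> 0 < y \<bullet> (Q *v y)"
    and "(norm (transpose A *v (Q *v y)))\<^sup>2 \<le> L_Q A Q * (y \<bullet> (Q *v y))"
proof -
  let ?N = "A ** transpose A"
  have "transpose Q = Q \<and> (\<forall>y. y \<noteq> 0 \<longrightarrow> 0 < y \<bullet> (Q *v y)) \<and>
    (\<forall>y. (norm (transpose A *v (Q *v y)))\<^sup>2 \<le> L_Q A Q * (y \<bullet> (Q *v y)))"
  proof (cases "Q = matrix_inv ?N")
    case True
    have quad: "y \<bullet> (?N *v y) = (norm (transpose A *v y))\<^sup>2" for y
      by (metis inner_commute inner_transpose_mult matrix_vector_mul_assoc power2_norm_eq_inner)
    have "y = 0" if "?N *v y = 0" for y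
      using quad[of y] that inj[of y] by (simp del: transpose_matrix_vector)
    then have "invertible ?N"
      by (simp add: invertible_left_inverse matrix_left_invertible_ker)
    then have NQ: "?N ** Q = mat 1" "Q ** ?N = mat 1"
      using someI_ex[of "\<lambda>B. ?N ** B = mat 1 \<and> B ** ?N = mat 1"]
      unfolding True matrix_inv_def invertible_def by blast+
    have "transpose ?N = ?N" by (simp add: matrix_transpose_mul)
    \<comment> \<open>The transpose of \<open>Q\<close> is a left inverse of \<open>?N\<close> and
      \<open>Q\<close> a right inverse, so they coincide.\<close>
    then have "transpose Q ** ?N = mat 1"
      using NQ(1) by (metis matrix_transpose_mul transpose_mat)
    then have sym: "transpose Q = Q"
      by (metis NQ(1) matrix_mul_assoc matrix_mul_lid matrix_mul_rid)
    have NQy: "?N *v (Q *v y) = y" for y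
      using NQ(1) by (simp add: matrix_vector_mul_assoc)
    have quadQ: "y \<bullet> (Q *v y) = (norm (transpose A *v (Q *v y)))\<^sup>2" for y
      using quad[of "Q *v y"] NQy[of y] by (metis inner_commute)
    have "transpose A *v (Q *v y) \<noteq> 0" if "y \<noteq> 0" for y
      using inj[of "Q *v y"] NQy[of y] that by (metis matrix_vector_mult_0_right)
    then show ?thesis
      using sym by (simp add: quadQ True[symmetric] L_Q_def del: transpose_matrix_vector)
  next
    case False
    then have [simp]: "Q = mat 1" using Q by simp
    have "(norm (transpose A *v y))\<^sup>2 \<le> (onorm (\<lambda>w. A *v w) * norm y)\<^sup>2" for y
      by (intro power_mono transpose_mult_norm_le) simp
    then show ?thesis
      using False by (simp add: L_Q_def transpose_mat power_mult_distrib power2_norm_eq_inner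
          del: transpose_matrix_vector)
  qed
  then show "transpose Q = Q" and "y \<noteq> 0 \<Longrightarrow> 0 < y \<bullet> (Q *v y)"
    and "(norm (transpose A *v (Q *v y)))\<^sup>2 \<le> L_Q A Q * (y \<bullet> (Q *v y))"
    by blast+
qed

lemma symmetric_inner_mult:
  fixes Q :: "real^'n^'n"
  assumes "transpose Q = Q"
  shows "x \<bullet> (Q *v y) = y \<bullet> (Q *v x)"
  by (metis assms inner_commute inner_transpose_mult)

lemma grad_f_Q_centered:
  assumes "A *v w0 = b"
  shows "grad_f_Q A b Q w = transpose A *v (Q *v (A *v (w - w0)))"
  using assms by (simp add: grad_f_Q_def matrix_vector_mult_diff_distrib)

text \<open>Substituting \<open>b = A *v w0\<close> completes the square; symmetry of
  \<open>Q\<close> merges the two cross terms.\<close>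

lemma f_Q_centered:
  fixes A :: "real^'m^'n"
  assumes Q: "transpose Q = Q" and b: "A *v w0 = b"
  shows "f_Q A b Q w = 1/2 * ((w - w0) \<bullet> (transpose A *v (Q *v (A *v (w - w0)))))"
  using symmetric_inner_mult[OF Q, of "A *v w" b] b
  unfolding f_Q_def inner_transpose_mult
  by (simp add: matrix_vector_mult_diff_distrib inner_diff algebra_simps)

theorem theorem6p13:
  fixes M :: "real^'n^'n" and b :: "real^'n" and A :: "real^('n + 'n)^'n"
  assumes "P_matrix M"
    and "A = lcp_matrix M"
  shows "\<exists>wstar. S1 A b \<inter> S2 = {wstar} \<and>
    (\<forall>Q \<in> {matrix_inv (A ** transpose A), mat 1}. \<forall>lam \<in> {0 <.. 1 / L_Q A Q}.
      (\<forall>z. objective A b Q wstar \<le> objective A b Q z) \<and> objective A b Q wstar = 0 \<and>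
      (\<forall>w :: nat \<Rightarrow> real^('n + 'n).
        (\<forall>k. w (Suc k) \<in> proj_set S2 (w k - lam *\<^sub>R grad_f_Q A b Q (w k))) \<longrightarrow>
        local_Q_linear w wstar \<and>
        local_Q_linear_ereal (\<lambda>k. objective A b Q (w k)) 0))"
proof -
  obtain w0 where w0: "w0 \<in> S2" and Aw0: "A *v w0 = b"
    using P_matrix_lcp_solvable[OF assms(1)] assms(2) by metis
  have unique: "w = w0" if "w \<in> S2" "A *v w = b" for w
    using P_matrix_lcp_kernel[OF assms(1) S2_diff_opposite_sign[OF that(1) w0]] that(2) Aw0 assms(2)
    by (simp add: matrix_vector_mult_diff_distrib)
  have inj: "y = 0" if "transpose A *v y = 0" for y
    using lcp_matrix_transpose_mult(2)[of M y] that
    by (simp add: assms(2) vec_eq_iff del: transpose_matrix_vector)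
  obtain \<epsilon> where \<epsilon>: "\<epsilon> > 0" "\<And>w. w \<in> S2 \<Longrightarrow> dist w w0 < \<epsilon> \<Longrightarrow> closed_segment w w0 \<subseteq> S2"
    using S2_locally_star_shaped[OF w0] by blast
  show ?thesis
  proof (intro exI[of _ w0] conjI ballI)
    show "S1 A b \<inter> S2 = {w0}"
      using w0 Aw0 unique unfolding S1_def by blast
  next
    fix Q lam assume Q: "Q \<in> {matrix_inv (A ** transpose A), mat 1}"
      and lam: "lam \<in> {0<..1 / L_Q A Q}"
    note Qp = weight_properties[OF inj Q]
    define H where "H x = transpose A *v (Q *v (A *v x))" for x
    \<comment> \<open>A nonpositive \<open>L_Q A Q\<close> would make \<open>1 / L_Q A Q\<close>
      nonpositive and the interval for \<open>lam\<close> empty.\<close>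
    have L: "L_Q A Q > 0"
      using lam less_le_trans[of 0 lam "1 / L_Q A Q"] by simp
    obtain \<mu> where \<mu>: "\<mu> > 0" "\<And>x. x \<in> opposite_sign_cone \<Longrightarrow> \<mu> * (norm x)\<^sup>2 \<le> x \<bullet> H x"
      using P_matrix_lcp_growth[OF assms(1) Qp(2), folded assms(2), folded H_def] by auto
    interpret projected_gradient S2 H w0 "L_Q A Q" \<mu> \<epsilon> lam
    proof (rule projected_gradient.intro)
      show "x \<bullet> H y = y \<bullet> H x" for x y
        unfolding H_def inner_transpose_mult by (rule symmetric_inner_mult[OF Qp(1)])
      show "(norm (H x))\<^sup>2 \<le> L_Q A Q * (x \<bullet> H x)" for x
        using Qp(3)[of "A *v x"] unfolding H_def inner_transpose_mult .
      show "lam > 0" "lam * L_Q A Q \<le> 1"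
        using lam L by (auto simp: field_simps)
      show "x = w0" if x: "x \<in> S2" and stat: "\<And>z. z \<in> S2 \<Longrightarrow>
        0 \<le> H (x - w0) \<bullet> (z - x) + 1 / (2 * lam) * (norm (z - x))\<^sup>2" for x
      proof (rule unique[OF x])
        \<comment> \<open>\<open>S2_stationary\<close> is applied to the weighted residual with
          \<open>C = 1 / (2 * lam)\<close>; definiteness of \<open>Q\<close> then removes the
          weight.\<close>
        have "Q *v (A *v (x - w0)) = 0"
          by (rule S2_stationary[OF assms(1) x]) (use stat in \<open>unfold H_def assms(2)\<close>)
        then have "A *v (x - w0) = 0"
          using Qp(2)[of "A *v (x - w0)"] by fastforce
        then show "A *v x = b" by (simp add: Aw0 matrix_vector_mult_diff_distrib)
      qed
      show "linear H" unfolding H_def[abs_def] by (rule linear_normal_map)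
    qed (use w0 \<mu> \<epsilon> L S2_diff_opposite_sign[OF _ w0] closed_S2 in auto)
    have f: "f_Q A b Q w = 1/2 * q w" for w
      unfolding H_def by (rule f_Q_centered[OF Qp(1) Aw0])
    have obj: "objective A b Q w = ereal (1/2 * q w)" if "w \<in> S2" for w
      using that by (simp add: objective_def f indicator_fun_def)
    show obj0: "objective A b Q w0 = 0"
      using obj[OF w0] by simp
    show "\<forall>z. objective A b Q w0 \<le> objective A b Q z"
      unfolding obj0 objective_def f
      using H_nonneg w0 by (auto simp: indicator_fun_def zero_ereal_def)
    show "\<forall>w. (\<forall>k. w (Suc k) \<in> proj_set S2 (w k - lam *\<^sub>R grad_f_Q A b Q (w k))) \<longrightarrow>
        local_Q_linear w w0 \<and> local_Q_linear_ereal (\<lambda>k. objective A b Q (w k)) 0"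
    proof (intro allI impI conjI)
      fix w assume "\<forall>k. w (Suc k) \<in> proj_set S2 (w k - lam *\<^sub>R grad_f_Q A b Q (w k))"
      then have w: "w (Suc k) \<in> proj_set S2 (w k - lam *\<^sub>R H (w k - w0))" for k
        by (simp add: H_def grad_f_Q_centered[OF Aw0])
      show "local_Q_linear w w0" by (rule iterates_local_Q_linear[where w = w, OF w])
      \<comment> \<open>This is only eventual, since the objective is infinite at a
        \<open>w 0\<close> outside \<open>S2\<close>.\<close>
      have ev: "\<forall>\<^sub>F k in sequentially. objective A b Q (w k) = ereal (1/2 * q (w k))"
        using iterates_eventually_near[where w = w, OF w] by eventually_elim (simp add: obj)
      have "(\<lambda>k. ereal (1/2 * q (w k))) \<longlonglongrightarrow> ereal (1/2 * 0)"
        by (intro tendsto_intros values_converge[where w = w, OF w])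
      then have lim: "(\<lambda>k. objective A b Q (w k)) \<longlonglongrightarrow> 0"
        using ev by (simp add: tendsto_cong zero_ereal_def)
      obtain \<kappa> where \<kappa>: "0 \<le> \<kappa>" "\<kappa> < 1"
        and rate: "\<forall>\<^sub>F k in sequentially. q (w (Suc k)) \<le> \<kappa> * q (w k)"
        by (rule values_linear_rate[where w = w, OF w])
      have "\<forall>\<^sub>F k in sequentially. \<bar>objective A b Q (w (Suc k)) - 0\<bar>
          \<le> ereal \<kappa> * \<bar>objective A b Q (w k) - 0\<bar>"
        using rate ev eventually_sequentially_Suc[THEN iffD2, OF ev]
      proof eventually_elim
        case (elim k)
        then show ?case using H_nonneg by simp
      qed
      then show "local_Q_linear_ereal (\<lambda>k. objective A b Q (w k)) 0"
        unfolding local_Q_linear_ereal_def using lim \<kappa> by blast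
    qed
  qed
qed

end
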